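(* Let $d \geq 1$ and $m \geq 4$ be integers and let $B$ be a subset of $[0,m-1]$ such that \[ B+B = [0,2m-2] \quad\text{and}\quad B-B = [-m+1, m-1]. \] Let $L^*$ be a $(d-1)$-dimensional arithmetic progression contained in $[0,m-1]\setminus B$ such that $\min(L^* ) - 1 \in B$. Let $k \geq 2$ be an integer and let $L$ be the $d$-dimensional arithmetic progression \[ L = (m - L^* ) + m\ast[1,k]. \] Let \[ a^* = \min(L)+\max(L) = (k+3)m - \min(L^* ) - \max(L^* ) \] and \[ A^* = B \cup L \cup (\{a^*\} - B). \] Then $A = A^* \cup \{m\}$ is an MSTD set of integers, i.e. $|A+A| > |A-A|$.
   Context: For integers $a,b$, $[a,b]$ denotes the interval of integers $\{a,a+1,\ldots,b\}$. For sets $A,B$ of integers, $A+B=\{a+b : a\in A, b\in B\}$ and $A-B=\{a-b : a\in A, b\in B\}$; for an integer $x$, $x-B=\{x-b: b\in B\}$ and $x\ast A = \{xa : a\in A\}$. $|A|$ denotes cardinality. A finite set $A$ is called an MSTD set (more sums than differences) if $|A+A|>|A-A|$. For $n\ge 1$, an $n$-dimensional (generalized) arithmetic progression of integers is a set of the form $\{a+x_1m_1+\cdots+x_nm_n : x_i\in\mathbf{Z},\ \ell_i \leq x_i \leq \ell_i+k_i-1 \text{ for } i=1,\ldots,n\}$ with integers $a, m_i, \ell_i$ and positive integers $k_i$; a $0$-dimensional arithmetic progression is a one-element set. *)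

theory Defs
  imports Complex_Main "HOL-Library.Set_Algebras"
begin

text \<open>
  Sumsets \<open>A + B\<close> and dilates \<open>x *o A\<close> are those of \<^theory>\<open>HOL-Library.Set_Algebras\<close>.
  On sets, \<open>A - B\<close> is the set-theoretic difference, so the difference set
  needs a name of its own.
\<close>

definition diffset :: "int set \<Rightarrow> int set \<Rightarrow> int set" where
  "diffset A B = {a - b | a b. a \<in> A \<and> b \<in> B}"

definition mstd :: "int set \<Rightarrow> bool" where
  "mstd A \<longleftrightarrow> finite A \<and> card (A + A) > card (diffset A A)"

text \<open>
  Progressions need not be proper: the \<open>m i\<close> are arbitrary integers (zero included), and
  different coordinate vectors may represent the same element. For \<open>n = 0\<close> the sum is empty
  and the set is \<open>{a}\<close>.
\<close>

definition arith_prog :: "nat \<Rightarrow> int set \<Rightarrow> bool" where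
  "arith_prog n P \<longleftrightarrow>
     (\<exists>(a::int) (m :: nat \<Rightarrow> int) (l :: nat \<Rightarrow> int) (k :: nat \<Rightarrow> int).
        (\<forall>i<n. k i > 0) \<and>
        P = {a + (\<Sum>i<n. x i * m i) | x :: nat \<Rightarrow> int. \<forall>i<n. l i \<le> x i \<and> x i \<le> l i + k i - 1})"

text \<open>
  Passing from \<open>P\<close> to \<open>(c - P) + q * [1,k]\<close> raises the dimension of a progression by one.
\<close>

lemma arith_prog_Suc:
  assumes "arith_prog n P" "k \<ge> 1"
  shows "arith_prog (Suc n) (diffset {c} P + q *o {1..k})"
proof -
  obtain a m l \<kappa> where pos: "\<forall>i<n. \<kappa> i > 0" and
    P: "P = {a + (\<Sum>i<n. x i * m i) | x :: nat \<Rightarrow> int. \<forall>i<n. l i \<le> x i \<and> x i \<le> l i + \<kappa> i - (1::int)}"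
    using assms(1) unfolding arith_prog_def by blast
  define m' where "m' = (\<lambda>i. if i = n then q else - m i)"
  define l' where "l' = l(n := 1)"
  define \<kappa>' where "\<kappa>' = \<kappa>(n := k)"
  have sum': "(\<Sum>i<Suc n. x i * m' i) = x n * q - (\<Sum>i<n. x i * m i)" for x :: "nat \<Rightarrow> int"
  proof -
    have "(\<Sum>i<n. x i * m' i) = (\<Sum>i<n. - (x i * m i))"
      by (rule sum.cong) (auto simp: m'_def)
    then show ?thesis by (simp add: m'_def sum_negf)
  qed
  have bounds': "(\<forall>i<Suc n. l' i \<le> x i \<and> x i \<le> l' i + \<kappa>' i - 1) \<longleftrightarrow>
      (\<forall>i<n. l i \<le> x i \<and> x i \<le> l i + \<kappa> i - 1) \<and> 1 \<le> x n \<and> x n \<le> k" for x :: "nat \<Rightarrow> int"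
    by (auto simp: l'_def \<kappa>'_def less_Suc_eq)
  have "diffset {c} P + q *o {1..k} =
      {c - a + (\<Sum>i<Suc n. x i * m' i) | x :: nat \<Rightarrow> int.
         \<forall>i<Suc n. l' i \<le> x i \<and> x i \<le> l' i + \<kappa>' i - 1}" (is "?S = ?T")
  proof (rule set_eqI, rule iffI)
    fix z assume "z \<in> ?S"
    then obtain x j where x: "\<forall>i<n. l i \<le> x i \<and> x i \<le> l i + \<kappa> i - 1"
      and j: "1 \<le> j" "j \<le> k" and z: "z = c - (a + (\<Sum>i<n. x i * m i)) + q * j"
      unfolding P diffset_def set_plus_def elt_set_times_def by auto
    have "(\<Sum>i<n. (x(n := j)) i * m i) = (\<Sum>i<n. x i * m i)"
      by (rule sum.cong) auto
    then have "z = c - a + (\<Sum>i<Suc n. (x(n := j)) i * m' i)"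
      unfolding sum' by (simp add: z algebra_simps)
    moreover have "\<forall>i<Suc n. l' i \<le> (x(n := j)) i \<and> (x(n := j)) i \<le> l' i + \<kappa>' i - 1"
      unfolding bounds' using x j by auto
    ultimately show "z \<in> ?T" by blast
  next
    fix z assume "z \<in> ?T"
    then obtain x where z: "z = c - a + (x n * q - (\<Sum>i<n. x i * m i))"
      and x: "\<forall>i<n. l i \<le> x i \<and> x i \<le> l i + \<kappa> i - 1" "1 \<le> x n" "x n \<le> k"
      unfolding sum' bounds' by blast
    have "z = (c - (a + (\<Sum>i<n. x i * m i))) + q * x n"
      by (simp add: z algebra_simps)
    moreover have "c - (a + (\<Sum>i<n. x i * m i)) \<in> diffset {c} P"
      unfolding P diffset_def using x(1) by blast
    moreover have "q * x n \<in> q *o {1..k}"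
      using x(2,3) by (auto simp: elt_set_times_def)
    ultimately show "z \<in> ?S" unfolding set_plus_def by blast
  qed
  moreover have "\<forall>i<Suc n. \<kappa>' i > 0"
    using pos assms(2) by (auto simp: \<kappa>'_def less_Suc_eq)
  ultimately show ?thesis unfolding arith_prog_def by blast
qed

lemma Min_plus_Max_reflected_prog:
  fixes P :: "int set" and m k :: int
  assumes "finite P" "P \<noteq> {}" "m \<ge> 0" "k \<ge> 1"
  defines "L \<equiv> diffset {m} P + m *o {1..k}"
  shows "Min L + Max L = (k + 3) * m - Min P - Max P"
proof -
  have L: "L = (\<lambda>(p, j). m - p + m * j) ` (P \<times> {1..k})"
    unfolding L_def diffset_def set_plus_def elt_set_times_def by force
  have fin: "finite L" unfolding L using assms(1) by simp
  have "Min P \<in> P" "Max P \<in> P" using assms by simp_all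
  have "Min L = m - Max P + m * 1"
  proof (rule Min_eqI[OF fin])
    show "m - Max P + m * 1 \<in> L" unfolding L using \<open>Max P \<in> P\<close> assms(4) by force
    fix y assume "y \<in> L"
    then obtain p j where "p \<in> P" "1 \<le> j" "y = m - p + m * j" unfolding L by auto
    moreover have "m * 1 \<le> m * j" using assms(3) \<open>1 \<le> j\<close> by (intro mult_left_mono)
    ultimately show "m - Max P + m * 1 \<le> y" using Max_ge[OF assms(1), of p] by linarith
  qed
  moreover have "Max L = m - Min P + m * k"
  proof (rule Max_eqI[OF fin])
    show "m - Min P + m * k \<in> L" unfolding L using \<open>Min P \<in> P\<close> assms(4) by force
    fix y assume "y \<in> L"
    then obtain p j where "p \<in> P" "j \<le> k" "y = m - p + m * j" unfolding L by auto
    moreover have "m * j \<le> m * k" using assms(3) \<open>j \<le> k\<close> by (intro mult_left_mono)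
    ultimately show "y \<le> m - Min P + m * k" using Min_le[OF assms(1), of p] by linarith
  qed
  ultimately show ?thesis by (simp add: algebra_simps)
qed

end

theory Submission
  imports Defs
begin

text \<open>
  Every arithmetic progression is symmetric, hence so is \<open>L\<close>, and therefore
  \<open>A\<^sup>* = a\<^sup>* - A\<^sup>*\<close>. For such a set, \<open>A\<^sup>* + A\<^sup>*\<close> is the translate by \<open>a\<^sup>*\<close> of the difference
  set \<open>A\<^sup>* - A\<^sup>*\<close>, so the two have the same cardinality (\<open>sumset_symmetric\<close>). Adjoining \<open>m\<close> to
  \<open>A\<^sup>*\<close> breaks this tie. It creates no new difference, because \<open>m - A\<^sup>* \<subseteq> A\<^sup>* - A\<^sup>*\<close>, but
  it creates the new sum \<open>2m\<close>: as \<open>B\<close> and \<open>L\<^sup>*\<close> are disjoint, \<open>2m\<close> is not a sum of two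
  elements of \<open>A\<^sup>*\<close>. This principle is \<open>mstd_insert_symmetric\<close>; for the
  given \<open>A\<^sup>*\<close> its hypotheses are checked by hand, and the only delicate difference is
  \<open>a\<^sup>* - (2m - 1)\<close>, for which \<open>min L\<^sup>* - 1 \<in> B\<close> is needed.
\<close>

section \<open>Difference sets\<close>

lemma diffset_iff: "x \<in> diffset X Y \<longleftrightarrow> (\<exists>a\<in>X. \<exists>b\<in>Y. x = a - b)"
  by (auto simp: diffset_def)

lemma diffset_uminus: "x \<in> diffset X X \<Longrightarrow> - x \<in> diffset X X"
  unfolding diffset_iff by (metis minus_diff_eq)

lemma finite_diffset:
  assumes "finite X" "finite Y"
  shows "finite (diffset X Y)"
proof -
  have "diffset X Y = (\<lambda>(a, b). a - b) ` (X \<times> Y)"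
    by (auto simp: diffset_def)
  then show ?thesis using assms by simp
qed

section \<open>Symmetry of arithmetic progressions\<close>

lemma arith_prog_nonempty:
  assumes "arith_prog n P"
  shows "P \<noteq> {}"
proof -
  obtain a m l \<kappa> where pos: "\<forall>i<n. \<kappa> i > 0" and
    P: "P = {a + (\<Sum>i<n. x i * m i) | x :: nat \<Rightarrow> int. \<forall>i<n. l i \<le> x i \<and> x i \<le> l i + \<kappa> i - (1::int)}"
    using assms unfolding arith_prog_def by blast
  have "\<forall>i<n. l i \<le> l i \<and> l i \<le> l i + \<kappa> i - 1"
    using pos by auto
  then have "a + (\<Sum>i<n. l i * m i) \<in> P"
    unfolding P by blast
  then show ?thesis by blast
qed

lemma arith_prog_symmetric:
  assumes "arith_prog n P"
  shows "\<exists>c. \<forall>p\<in>P. c - p \<in> P"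
proof -
  obtain a m l \<kappa> where
    P: "P = {a + (\<Sum>i<n. x i * m i) | x :: nat \<Rightarrow> int. \<forall>i<n. l i \<le> x i \<and> x i \<le> l i + \<kappa> i - (1::int)}"
    using assms unfolding arith_prog_def by blast
  \<comment> \<open>Reflecting every coordinate range onto itself reflects the progression.\<close>
  define r where "r x = (\<lambda>i. 2 * l i + \<kappa> i - 1 - x i)" for x :: "nat \<Rightarrow> int"
  define c where "c = 2 * a + (\<Sum>i<n. (2 * l i + \<kappa> i - 1) * m i)"
  have "c - p \<in> P" if pP: "p \<in> P" for p
  proof -
    obtain x where p: "p = a + (\<Sum>i<n. x i * m i)"
      and x: "\<forall>i<n. l i \<le> x i \<and> x i \<le> l i + \<kappa> i - 1"
      using pP unfolding P by blast
    have "(\<Sum>i<n. r x i * m i) = (\<Sum>i<n. (2 * l i + \<kappa> i - 1) * m i) - (\<Sum>i<n. x i * m i)"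
      by (simp add: r_def sum_subtractf[symmetric] left_diff_distrib)
    then have "c - p = a + (\<Sum>i<n. r x i * m i)"
      by (simp add: c_def p)
    moreover have "\<forall>i<n. l i \<le> r x i \<and> r x i \<le> l i + \<kappa> i - 1"
      using x by (auto simp: r_def)
    ultimately show "c - p \<in> P" unfolding P by blast
  qed
  then show ?thesis by blast
qed

lemma symmetric_center:
  fixes P :: "int set"
  assumes "finite P" "P \<noteq> {}" and sym: "\<forall>p\<in>P. c - p \<in> P"
  shows "c = Min P + Max P"
proof -
  have mem: "Min P \<in> P" "Max P \<in> P" using assms by simp_all
  have "c - Min P \<le> Max P" "Min P \<le> c - Max P"
    using mem sym assms(1) by simp_all
  then show ?thesis by linarith
qed

section \<open>MSTD sets from symmetric sets\<close>

lemma sumset_symmetric: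
  fixes X :: "int set"
  assumes sym: "\<forall>x\<in>X. c - x \<in> X"
  shows "X + X = (+) c ` diffset X X"
proof (intro set_eqI iffI)
  fix z assume "z \<in> X + X"
  then obtain x y where "x \<in> X" "y \<in> X" and z: "z = x + y"
    by (auto simp: set_plus_def)
  then have "x - (c - y) \<in> diffset X X"
    using sym by (auto simp: diffset_iff)
  moreover have "z = c + (x - (c - y))" by (simp add: z)
  ultimately show "z \<in> (+) c ` diffset X X" by blast
next
  fix z assume "z \<in> (+) c ` diffset X X"
  then obtain x y where "x \<in> X" "y \<in> X" and "z = x + (c - y)"
    by (auto simp: diffset_iff)
  then show "z \<in> X + X" using sym by blast
qed

lemma mstd_insert_symmetric:
  fixes X :: "int set"
  assumes "finite X"
    and sym: "\<forall>x\<in>X. c - x \<in> X"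
    and old: "\<forall>x\<in>insert m X. m - x \<in> diffset X X"
    and new: "2 * m \<notin> X + X"
  shows "mstd (insert m X)"
proof -
  have diffs: "diffset (insert m X) (insert m X) \<subseteq> diffset X X"
  proof
    fix z assume "z \<in> diffset (insert m X) (insert m X)"
    then obtain x y where x: "x \<in> insert m X" and y: "y \<in> insert m X" and z: "z = x - y"
      unfolding diffset_iff by blast
    consider "x = m" | "y = m" | "x \<in> X" "y \<in> X" using x y by blast
    then show "z \<in> diffset X X"
    proof cases
      case 1
      then show ?thesis using old y z by blast
    next
      case 2
      have "m - x \<in> diffset X X" using old x by blast
      from diffset_uminus[OF this] show ?thesis using 2 z by simp
    next
      case 3
      then show ?thesis using z by (auto simp: diffset_iff)
    qed
  qed
  have "2 * m \<in> insert m X + insert m X"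
    using set_plus_intro[of m "insert m X" m "insert m X"] by simp
  moreover have "X + X \<subseteq> insert m X + insert m X"
    by (intro set_plus_mono2) auto
  ultimately have sums: "X + X \<subset> insert m X + insert m X"
    using new by blast
  have "card (diffset (insert m X) (insert m X)) \<le> card (diffset X X)"
    using diffs assms(1) by (intro card_mono finite_diffset)
  also have "\<dots> = card (X + X)"
    by (simp add: sumset_symmetric[OF sym] card_image)
  also have "\<dots> < card (insert m X + insert m X)"
    using sums assms(1) by (intro psubset_card_mono finite_set_plus) auto
  finally show ?thesis using assms(1) by (simp add: mstd_def)
qed

section \<open>Adjoining a point to a symmetric set built from a progression\<close>

theorem theorem4:
  fixes d :: nat and m k a_star :: int and B L_star L A_star A :: "int set"
  assumes "d \<ge> 1" and "m \<ge> 4"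
    and "B \<subseteq> {0..m - 1}"
    and "B + B = {0..2 * m - 2}"
    and "diffset B B = {- m + 1..m - 1}"
    and "arith_prog (d - 1) L_star"
    and "L_star \<subseteq> {0..m - 1} - B"
    and "Min L_star - 1 \<in> B"
    and "k \<ge> 2"
    and "L = diffset {m} L_star + m *o {1..k}"
    and "a_star = Min L + Max L"
    and "A_star = B \<union> L \<union> diffset {a_star} B"
    and "A = A_star \<union> {m}"
  shows "mstd A"
proof -
  define u where "u = Min L_star"
  define v where "v = Max L_star"
  have B_bounds: "0 \<le> b \<and> b \<le> m - 1" if "b \<in> B" for b
    using assms(3) that by auto
  have "finite B" using assms(3) finite_subset by blast
  have fin: "finite L_star" using assms(7) finite_subset by blast
  have ne: "L_star \<noteq> {}" by (rule arith_prog_nonempty[OF assms(6)])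
  have uv: "u \<in> L_star" "v \<in> L_star" using fin ne by (simp_all add: u_def v_def)

  have B_ends: "0 \<in> B" "m - 1 \<in> B"
  proof -
    have "0 \<in> B + B" using assms(2,4) by simp
    then obtain x y where "x \<in> B" "y \<in> B" "0 = x + y" by (auto simp: set_plus_def)
    moreover from this have "x = 0" using B_bounds[of x] B_bounds[of y] by linarith
    ultimately show "0 \<in> B" by simp
    have "2 * m - 2 \<in> B + B" using assms(2,4) by simp
    then obtain x y where "x \<in> B" "y \<in> B" "2 * m - 2 = x + y" by (auto simp: set_plus_def)
    moreover from this have "x = m - 1" using B_bounds[of x] B_bounds[of y] by linarith
    ultimately show "m - 1 \<in> B" by simp
  qed
  have Ls_bounds: "1 \<le> l \<and> l \<le> m - 2" if "l \<in> L_star" for l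
  proof -
    have "l \<noteq> 0" "l \<noteq> m - 1" "0 \<le> l" "l \<le> m - 1" using assms(7) that B_ends by auto
    then show ?thesis by linarith
  qed

  have L: "x \<in> L \<longleftrightarrow> (\<exists>l\<in>L_star. \<exists>j. 1 \<le> j \<and> j \<le> k \<and> x = m - l + m * j)" for x
    unfolding assms(10) diffset_def set_plus_def elt_set_times_def by force
  have L_I: "m - l + m * j \<in> L" if "l \<in> L_star" "1 \<le> j" "j \<le> k" for l j
    using that L by blast
  have a_star: "a_star = (k + 3) * m - u - v"
    using Min_plus_Max_reflected_prog[OF fin ne, of m k] assms(2,9)
    by (simp add: assms(10,11) u_def v_def)
  have A_star: "x \<in> A_star \<longleftrightarrow> x \<in> B \<or> x \<in> L \<or> (\<exists>b\<in>B. x = a_star - b)" for x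
    by (auto simp: assms(12) diffset_iff)
  have A_star_I: "x \<in> B \<Longrightarrow> x \<in> A_star" "x \<in> L \<Longrightarrow> x \<in> A_star"
    "x \<in> B \<Longrightarrow> a_star - x \<in> A_star" for x
    using A_star by auto
  have A_star_diff: "x - y \<in> diffset A_star A_star" if "x \<in> A_star" "y \<in> A_star" for x y
    using that by (auto simp: diffset_iff)

  have "finite A_star"
  proof -
    have "finite (m *o {1..k})"
      unfolding elt_set_times_def by (rule finite_subset[of _ "(*) m ` {1..k}"]) auto
    then show ?thesis
      unfolding assms(10,12) using fin \<open>finite B\<close>
      by (intro finite_UnI finite_set_plus finite_diffset) auto
  qed

  \<comment> \<open>By symmetry of \<open>L\<^sup>*\<close> about its centre, reflection in \<open>a\<^sup>*\<close> maps \<open>L\<close> onto itself,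
      exchanging \<open>j\<close> with \<open>k + 1 - j\<close>; it swaps \<open>B\<close> and \<open>a\<^sup>* - B\<close>.\<close>
  have L_star_sym: "u + v - l \<in> L_star" if "l \<in> L_star" for l
    using arith_prog_symmetric[OF assms(6)] symmetric_center[OF fin ne] that
    unfolding u_def v_def by blast
  have "a_star - x \<in> A_star" if x_in: "x \<in> A_star" for x
  proof -
    consider "x \<in> B" | "x \<in> L" | b where "b \<in> B" "x = a_star - b"
      using x_in A_star by blast
    then show ?thesis
    proof cases
      case 2
      then obtain l j where l: "l \<in> L_star" "1 \<le> j" "j \<le> k" and x: "x = m - l + m * j"
        using L by blast
      have "a_star - x = m - (u + v - l) + m * (k + 1 - j)"
        by (simp add: a_star x algebra_simps)
      moreover have "m - (u + v - l) + m * (k + 1 - j) \<in> L"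
        using L_star_sym l by (intro L_I) auto
      ultimately show ?thesis using A_star_I by simp
    qed (use A_star_I in auto)
  qed
  then have sym: "\<forall>x\<in>A_star. a_star - x \<in> A_star" by blast

  have small: "z \<in> diffset A_star A_star" if "\<bar>z\<bar> \<le> m - 1" for z
  proof -
    have "z \<in> diffset B B" using assms(5) that by auto
    then show ?thesis using A_star_I by (auto simp: diffset_iff)
  qed
  have diff_m: "m \<in> diffset A_star A_star"
  proof -
    \<comment> \<open>As \<open>k \<ge> 2\<close>, two consecutive translates of \<open>m - u\<close> lie in \<open>L\<close>.\<close>
    have "(m - u + m * 2) - (m - u + m * 1) \<in> diffset A_star A_star"
      using assms(9) uv(1) by (intro A_star_diff A_star_I(2) L_I) auto
    then show ?thesis by simp
  qed

  have old: "m - x \<in> diffset A_star A_star" if x_in: "x \<in> insert m A_star" for x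
  proof -
    consider "x = m" | "x \<in> B" | "x \<in> L" | b where "b \<in> B" "x = a_star - b"
      using x_in A_star by blast
    then show ?thesis
    proof cases
      case 1
      then show ?thesis using small[of 0] assms(2) by simp
    next
      case 2
      show ?thesis
      proof (cases "x = 0")
        case True
        then show ?thesis using diff_m by simp
      next
        case False
        then show ?thesis using B_bounds[OF 2] by (intro small) auto
      qed
    next
      case 3
      then obtain l j where l: "l \<in> L_star" "1 \<le> j" "j \<le> k" and x: "x = m - l + m * j"
        using L by blast
      show ?thesis
      proof (cases "j = 1")
        case True
        then show ?thesis using Ls_bounds[OF l(1)] x by (intro small) auto
      next
        case False
        then have "m - l + m * (j - 1) \<in> L" using l by (intro L_I) auto
        then have "0 - (m - l + m * (j - 1)) \<in> diffset A_star A_star"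
          using B_ends A_star_I by (intro A_star_diff) auto
        moreover have "0 - (m - l + m * (j - 1)) = m - x" by (simp add: x algebra_simps)
        ultimately show ?thesis by (simp only:)
      qed
    next
      case (4 b)
      show ?thesis
      proof (cases "b = m - 1")
        case True
        \<comment> \<open>The sum \<open>m + b = 2m - 1\<close> is just out of reach of \<open>B + B\<close>; here \<open>u - 1 \<in> B\<close> and
            \<open>(k + 1) m - v \<in> L\<close> supply the difference instead.\<close>
        have "(u - 1) - (m - v + m * k) \<in> diffset A_star A_star"
          using assms(8,9) uv A_star_I L_I by (intro A_star_diff) (auto simp: u_def)
        moreover have "(u - 1) - (m - v + m * k) = m - x"
          by (simp add: 4 True a_star algebra_simps)
        ultimately show ?thesis by (simp only:)
      next
        case False
        then have "m + b \<in> B + B" using B_bounds[OF 4(1)] assms(2,4) by simp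
        then obtain p q where pq: "p \<in> B" "q \<in> B" "m + b = p + q"
          by (auto simp: set_plus_def)
        have "p - (a_star - q) \<in> diffset A_star A_star"
          using pq A_star_I by (intro A_star_diff) auto
        moreover have "p - (a_star - q) = m - x" using pq(3) 4(2) by simp
        ultimately show ?thesis by (simp only:)
      qed
    qed
  qed

  have m_mult: "m * i \<le> m * j" if "i \<le> j" for i j
    using that assms(2) by (intro mult_left_mono) auto
  have L_lower: "m + 2 \<le> x" if x_in: "x \<in> L" for x
  proof -
    obtain l j where l: "l \<in> L_star" "1 \<le> j" and x: "x = m - l + m * j"
      using x_in L by blast
    show ?thesis using Ls_bounds[OF l(1)] m_mult[OF l(2)] x by linarith
  qed
  have refl_lower: "2 * m + 5 \<le> a_star - b" if "b \<in> B" for b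
    using B_bounds[OF that] Ls_bounds[OF uv(1)] Ls_bounds[OF uv(2)] m_mult[OF assms(9)]
    unfolding a_star distrib_right mult.commute[of k m] by linarith
  have BL: "b + x \<noteq> 2 * m" if b: "b \<in> B" and x_in: "x \<in> L" for b x
  proof
    assume eq: "b + x = 2 * m"
    obtain l j where l: "l \<in> L_star" "1 \<le> j" and x: "x = m - l + m * j"
      using x_in L by blast
    have "j = 1"
    proof (rule ccontr)
      assume "j \<noteq> 1"
      then have "m * 2 \<le> m * j" using l by (intro m_mult) simp
      then show False using eq x B_bounds[OF b] Ls_bounds[OF l(1)] by linarith
    qed
    then have "b = l" using eq x by simp
    then show False using assms(7) l b by blast
  qed
  have "x + y \<noteq> 2 * m" if x: "x \<in> A_star" and y: "y \<in> A_star" for x y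
  proof -
    have nonneg: "0 \<le> z" if "z \<in> A_star" for z
      using that A_star B_bounds L_lower refl_lower assms(2) by force
    consider "x \<in> B" "y \<in> B" | "x \<in> B" "y \<in> L" | "x \<in> L" "y \<in> B" | "x \<in> L" "y \<in> L"
      | "x \<ge> 2 * m + 5" | "y \<ge> 2 * m + 5"
      using x y A_star refl_lower by metis
    then show ?thesis
    proof cases
      case 1
      then show ?thesis using B_bounds[of x] B_bounds[of y] by linarith
    next
      case 2
      then show ?thesis by (rule BL)
    next
      case 3
      then show ?thesis using BL[of y x] by (simp add: add.commute)
    next
      case 4
      then show ?thesis using L_lower[of x] L_lower[of y] by linarith
    next
      case 5
      then show ?thesis using nonneg[OF y] by linarith
    next
      case 6
      then show ?thesis using nonneg[OF x] by linarith
    qed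
  qed
  then have new: "2 * m \<notin> A_star + A_star"
    by (auto simp: set_plus_def) metis

  have "mstd (insert m A_star)"
    using mstd_insert_symmetric[OF \<open>finite A_star\<close> sym _ new] old by blast
  then show ?thesis by (simp add: assms(13))
qed

end
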